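(* Let $X$ be a weighted pure $n$-dimensional finite simplicial complex. For every $0\le k\le n-1$ and every $\phi\in C_0^k(X,\mathbb{R})$ there are $\phi^k\in C_0^k(X,\mathbb{R})$ and $\phi^{j},(\phi^{j})'\in C_0^{j}(X,\mathbb{R})$ for $0\le j\le k-1$ such that, denoting $(\phi^k)'=\phi$, the following hold: 1. For every $0\le j\le k$, $\|(\phi^j)'\|^2=\|\phi^j\|^2+\|\phi^{j-1}\|^2+\dots+\|\phi^0\|^2$. 2. $$\|d_k\phi\|^2=\sum_{j=0}^k(k+1-j)\|\phi^j\|^2+\sum_{j=0}^k\sum_{\tau\in X(j-1)}\left\langle (M')^+_{\tau,0}(I-M^-_{\tau,0})(\phi^j)'_\tau,\,(\phi^j)'_\tau\right\rangle.$$
   Context: A finite simplicial complex $X$ is pure $n$-dimensional ($n\ge1$) if every simplex is contained in an $n$-dimensional simplex. $X(k)$ is the set of $k$-dimensional simplices, with $X(-1)=\{\emptyset\}$. A weight function is a map $m:\bigcup_{-1\le k\le n}X(k)\to(0,\infty)$ with $m(\tau)=\sum_{\sigma\in X(k+1),\,\tau\subset\sigma}m(\sigma)$ for all $-1\le k\le n-1$, $\tau\in X(k)$. $C^k(X,\mathbb{R})$ is the space of all functions $X(k)\to\mathbb{R}$ with inner product $\langle\phi,\psi\rangle=\sum_{\sigma\in X(k)}m(\sigma)\phi(\sigma)\psi(\sigma)$ and norm $\|\cdot\|$. $C_0^k(X,\mathbb{R})=\{\phi\in C^k(X,\mathbb{R}):\sum_{\sigma\in X(k)}m(\sigma)\phi(\sigma)=0\}$.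 Signless differential: $d_k:C^k(X,\mathbb{R})\to C^{k+1}(X,\mathbb{R})$, $d_k\phi(\sigma)=\sum_{\tau\in X(k),\,\tau\subset\sigma}\phi(\tau)$. For $\tau\in X(j-1)$ with $0\le j\le n-1$, the link $X_\tau$ is the complex of all simplices $\eta$ disjoint from $\tau$ with $\tau\cup\eta\in X$, with weight $m_\tau(\eta)=m(\tau\cup\eta)$; $C^l(X_\tau,\mathbb{R})$ and its inner product are defined using $m_\tau$. For $\psi\in C^j(X,\mathbb{R})$, the localization $\psi_\tau\in C^0(X_\tau,\mathbb{R})$ is $\psi_\tau(\{v\})=\psi(\tau\cup\{v\})$. On $C^0(X_\tau,\mathbb{R})$: $(M')^+_{\tau,0}f(\{v\})=\sum_{w:\{v,w\}\in X_\tau(1)}\frac{m_\tau(\{v,w\})}{m_\tau(\{v\})}f(\{w\})$ (the non-lazy upper walk) and $M^-_{\tau,0}f(\{v\})=\sum_{\{w\}\in X_\tau(0)}\frac{m_\tau(\{w\})}{m_\tau(\emptyset)}f(\{w\})$ (the lower walk, i.e. the orthogonal projection onto constants). *)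

theory Defs
  imports Complex_Main
begin

text \<open>
  Complexes are abstract: a simplex is a finite set of vertices, and the empty simplex
  belongs to the complex, so that \<open>faces X (-1) = {{}}\<close>. Dimensions are integers.
\<close>

definition simplicial_complex :: "'a set set \<Rightarrow> bool" where
  "simplicial_complex X \<longleftrightarrow>
     {} \<in> X \<and> (\<forall>\<sigma>\<in>X. finite \<sigma>) \<and> (\<forall>\<sigma>\<in>X. \<forall>\<tau>. \<tau> \<subseteq> \<sigma> \<longrightarrow> \<tau> \<in> X)"

definition faces :: "'a set set \<Rightarrow> int \<Rightarrow> 'a set set" where
  "faces X k = {\<sigma> \<in> X. int (card \<sigma>) = k + 1}"

definition pure_complex :: "nat \<Rightarrow> 'a set set \<Rightarrow> bool" where
  "pure_complex n X \<longleftrightarrow>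
     finite X \<and> simplicial_complex X \<and> (\<forall>\<tau>\<in>X. \<exists>\<sigma>\<in>faces X (int n). \<tau> \<subseteq> \<sigma>)"

definition weight_function :: "nat \<Rightarrow> 'a set set \<Rightarrow> ('a set \<Rightarrow> real) \<Rightarrow> bool" where
  "weight_function n X m \<longleftrightarrow>
     (\<forall>k\<in>{-1..int n}. \<forall>\<sigma>\<in>faces X k. m \<sigma> > 0) \<and>
     (\<forall>k\<in>{-1..int n - 1}. \<forall>\<tau>\<in>faces X k.
        m \<tau> = (\<Sum>\<sigma> | \<sigma> \<in> faces X (k + 1) \<and> \<tau> \<subseteq> \<sigma>. m \<sigma>))"

text \<open>
  A function \<open>X(k) \<rightarrow> \<real>\<close> is represented by its extension by zero to all sets of vertices.
\<close>

definition cochains :: "'a set set \<Rightarrow> int \<Rightarrow> ('a set \<Rightarrow> real) set" where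
  "cochains X k = {\<phi>. \<forall>\<sigma>. \<sigma> \<notin> faces X k \<longrightarrow> \<phi> \<sigma> = 0}"

definition cochain_inner ::
    "'a set set \<Rightarrow> ('a set \<Rightarrow> real) \<Rightarrow> int \<Rightarrow> ('a set \<Rightarrow> real) \<Rightarrow> ('a set \<Rightarrow> real) \<Rightarrow> real" where
  "cochain_inner X m k \<phi> \<psi> = (\<Sum>\<sigma>\<in>faces X k. m \<sigma> * \<phi> \<sigma> * \<psi> \<sigma>)"

definition cochain_norm ::
    "'a set set \<Rightarrow> ('a set \<Rightarrow> real) \<Rightarrow> int \<Rightarrow> ('a set \<Rightarrow> real) \<Rightarrow> real" where
  "cochain_norm X m k \<phi> = sqrt (cochain_inner X m k \<phi> \<phi>)"

definition cochains0 ::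
    "'a set set \<Rightarrow> ('a set \<Rightarrow> real) \<Rightarrow> int \<Rightarrow> ('a set \<Rightarrow> real) set" where
  "cochains0 X m k = {\<phi> \<in> cochains X k. (\<Sum>\<sigma>\<in>faces X k. m \<sigma> * \<phi> \<sigma>) = 0}"

definition signless_diff ::
    "'a set set \<Rightarrow> int \<Rightarrow> ('a set \<Rightarrow> real) \<Rightarrow> 'a set \<Rightarrow> real" where
  "signless_diff X k \<phi> =
     (\<lambda>\<sigma>. if \<sigma> \<in> faces X (k + 1) then \<Sum>\<tau> | \<tau> \<in> faces X k \<and> \<tau> \<subseteq> \<sigma>. \<phi> \<tau> else 0)"

definition link :: "'a set set \<Rightarrow> 'a set \<Rightarrow> 'a set set" where
  "link X \<tau> = {\<eta> \<in> X. \<eta> \<inter> \<tau> = {} \<and> \<tau> \<union> \<eta> \<in> X}"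

definition link_weight :: "('a set \<Rightarrow> real) \<Rightarrow> 'a set \<Rightarrow> 'a set \<Rightarrow> real" where
  "link_weight m \<tau> = (\<lambda>\<eta>. m (\<tau> \<union> \<eta>))"

definition localization ::
    "'a set set \<Rightarrow> 'a set \<Rightarrow> ('a set \<Rightarrow> real) \<Rightarrow> 'a set \<Rightarrow> real" where
  "localization X \<tau> \<psi> = (\<lambda>\<eta>. if \<eta> \<in> faces (link X \<tau>) 0 then \<psi> (\<tau> \<union> \<eta>) else 0)"

text \<open>
  The walks act on 0-cochains, i.e. on functions of the singletons \<open>\<eta> = {v}\<close> and \<open>\<omega> = {w}\<close>.
  In \<open>upper_walk\<close> the condition \<open>\<eta> \<union> \<omega> \<in> faces Y 1\<close> says that \<open>{v, w}\<close> is an edge; in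
  particular \<open>v \<noteq> w\<close>, so the walk is non-lazy.
\<close>

definition upper_walk ::
    "'a set set \<Rightarrow> ('a set \<Rightarrow> real) \<Rightarrow> ('a set \<Rightarrow> real) \<Rightarrow> 'a set \<Rightarrow> real" where
  "upper_walk Y \<mu> f =
     (\<lambda>\<eta>. if \<eta> \<in> faces Y 0
           then \<Sum>\<omega> | \<omega> \<in> faces Y 0 \<and> \<eta> \<union> \<omega> \<in> faces Y 1. \<mu> (\<eta> \<union> \<omega>) / \<mu> \<eta> * f \<omega>
           else 0)"

definition lower_walk ::
    "'a set set \<Rightarrow> ('a set \<Rightarrow> real) \<Rightarrow> ('a set \<Rightarrow> real) \<Rightarrow> 'a set \<Rightarrow> real" where
  "lower_walk Y \<mu> f =
     (\<lambda>\<eta>. if \<eta> \<in> faces Y 0 then \<Sum>\<omega>\<in>faces Y 0. \<mu> \<omega> / \<mu> {} * f \<omega> else 0)"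

end

theory Submission
  imports Defs "HOL-Analysis.Convex"
begin

text \<open>
  Let \<open>d\<close> be the signless differential and \<open>d\<^sup>*\<close> its adjoint, the weighted average over cofaces.
  Everything rests on one identity, valid for each \<open>j\<close>-cochain \<open>\<phi>\<close> with \<open>0 \<le> j < n\<close>:
  \<open>\<parallel>d \<phi>\<parallel>\<^sup>2 = \<parallel>\<phi>\<parallel>\<^sup>2 + L \<phi> + \<parallel>d\<^sup>* \<phi>\<parallel>\<^sup>2\<close>,
  where \<open>L \<phi>\<close> is the sum over the \<open>(j-1)\<close>-faces \<open>\<tau>\<close> of the local terms
  \<open>\<langle>(M')\<^sup>+ (I - M\<^sup>-) \<phi>\<^sub>\<tau>, \<phi>\<^sub>\<tau>\<rangle>\<close> (lemma \<open>diff_norm_recursion\<close>). To see it, expand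
  the square in \<open>\<parallel>d \<phi>\<parallel>\<^sup>2\<close>. The diagonal gives \<open>\<parallel>\<phi>\<parallel>\<^sup>2\<close> by the balance condition on the weight,
  and each remaining pair of \<open>j\<close>-faces of a common \<open>(j+1)\<close>-face meets in exactly one
  \<open>(j-1)\<close>-face \<open>\<tau>\<close>, so it is counted once among the links, by \<open>\<langle>(M')\<^sup>+ \<phi>\<^sub>\<tau>, \<phi>\<^sub>\<tau>\<rangle>\<close>.
  Finally \<open>M\<^sup>- \<phi>\<^sub>\<tau>\<close> is the constant \<open>d\<^sup>* \<phi> (\<tau>)\<close>, which the walk \<open>(M')\<^sup>+\<close> fixes, so
  the \<open>M\<^sup>-\<close> parts sum to \<open>\<parallel>d\<^sup>* \<phi>\<parallel>\<^sup>2\<close>.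

  It remains to turn \<open>\<parallel>d\<^sup>* \<phi>\<parallel>\<^sup>2\<close> into \<open>\<parallel>d \<xi>\<parallel>\<^sup>2\<close> for some \<open>\<xi>\<close> one dimension lower, of mean zero
  and with \<open>\<parallel>\<xi>\<parallel> \<le> \<parallel>\<phi>\<parallel>\<close>, and to recurse (lemma \<open>descend\<close>). A multiple \<open>\<xi> = c d\<^sup>* \<phi>\<close> does it: fix
  \<open>c\<close> by \<open>\<parallel>d \<xi>\<parallel> = \<parallel>d\<^sup>* \<phi>\<parallel>\<close>; then
  \<open>\<parallel>d\<^sup>* \<phi>\<parallel>\<^sup>2 = \<langle>d d\<^sup>* \<phi>, \<phi>\<rangle> \<le> \<parallel>d d\<^sup>* \<phi>\<parallel> \<parallel>\<phi>\<parallel>\<close> says exactly that \<open>\<parallel>\<xi>\<parallel> \<le> \<parallel>\<phi>\<parallel>\<close>.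
  Take \<open>(\<phi>\<^sup>j)'\<close> to be the cochains reached by this descent. Of \<open>\<phi>\<^sup>j\<close> only the norm matters,
  with square \<open>\<parallel>(\<phi>\<^sup>j)'\<parallel>\<^sup>2 - \<parallel>(\<phi>\<^sup>j\<^sup>-\<^sup>1)'\<parallel>\<^sup>2 \<ge> 0\<close>, so a multiple of \<open>(\<phi>\<^sup>j)'\<close> serves. The
  coefficient \<open>k + 1 - j\<close> counts the norms \<open>\<parallel>(\<phi>\<^sup>i)'\<parallel>\<^sup>2\<close>, \<open>j \<le> i \<le> k\<close>, in which \<open>\<parallel>\<phi>\<^sup>j\<parallel>\<^sup>2\<close> occurs.
\<close>

section \<open>Cochains and the adjoint of the signless differential\<close>

text \<open>
  The adjoint of \<open>signless_diff X k\<close> (lemma \<open>codiff_adjoint\<close>), which lowers the dimension to \<open>k\<close>.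
\<close>

definition codiff ::
    "'a set set \<Rightarrow> ('a set \<Rightarrow> real) \<Rightarrow> int \<Rightarrow> ('a set \<Rightarrow> real) \<Rightarrow> 'a set \<Rightarrow> real" where
  "codiff X m k \<phi> =
     (\<lambda>\<tau>. if \<tau> \<in> faces X k
          then \<Sum>\<sigma> | \<sigma> \<in> faces X (k + 1) \<and> \<tau> \<subseteq> \<sigma>. m \<sigma> / m \<tau> * \<phi> \<sigma> else 0)"

lemma cochain_inner_scale:
  "cochain_inner X m k (\<lambda>\<sigma>. c * \<phi> \<sigma>) (\<lambda>\<sigma>. c * \<phi> \<sigma>) = c\<^sup>2 * cochain_inner X m k \<phi> \<phi>"
  by (simp add: cochain_inner_def sum_distrib_left power2_eq_square algebra_simps)

lemma signless_diff_scale: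
  "signless_diff X k (\<lambda>\<tau>. c * \<phi> \<tau>) = (\<lambda>\<sigma>. c * signless_diff X k \<phi> \<sigma>)"
  by (auto simp: signless_diff_def sum_distrib_left)

lemma cochains0_scale:
  assumes "\<phi> \<in> cochains0 X m k"
  shows "(\<lambda>\<sigma>. c * \<phi> \<sigma>) \<in> cochains0 X m k"
proof -
  have "(\<Sum>\<sigma>\<in>faces X k. m \<sigma> * (c * \<phi> \<sigma>)) = c * (\<Sum>\<sigma>\<in>faces X k. m \<sigma> * \<phi> \<sigma>)"
    by (simp add: sum_distrib_left algebra_simps)
  with assms show ?thesis
    by (auto simp: cochains0_def cochains_def)
qed

definition local_form ::
    "'a set set \<Rightarrow> ('a set \<Rightarrow> real) \<Rightarrow> ('a set \<Rightarrow> real) \<Rightarrow> 'a set \<Rightarrow> real" where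
  "local_form X m \<phi> \<tau> =
     cochain_inner (link X \<tau>) (link_weight m \<tau>) 0
       (upper_walk (link X \<tau>) (link_weight m \<tau>)
         (\<lambda>\<eta>. localization X \<tau> \<phi> \<eta> -
            lower_walk (link X \<tau>) (link_weight m \<tau>) (localization X \<tau> \<phi>) \<eta>))
       (localization X \<tau> \<phi>)"

locale weighted_complex =
  fixes n :: nat and X :: "'a set set" and m :: "'a set \<Rightarrow> real"
  assumes pure: "pure_complex n X"
    and weight: "weight_function n X m"
begin

lemma finite_faces [simp]: "finite (faces X k)"
  using pure by (auto simp: pure_complex_def faces_def)

lemma finite_face: "\<sigma> \<in> faces X k \<Longrightarrow> finite \<sigma>"
  using pure by (auto simp: pure_complex_def faces_def simplicial_complex_def)

lemma subface: "\<sigma> \<in> X \<Longrightarrow> \<tau> \<subseteq> \<sigma> \<Longrightarrow> \<tau> \<in> X"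
  using pure by (auto simp: pure_complex_def simplicial_complex_def)

lemma weight_pos:
  assumes "\<sigma> \<in> faces X k" "k \<le> int n"
  shows "m \<sigma> > 0"
proof -
  have "k \<ge> -1"
    using assms(1) unfolding faces_def by auto
  then show ?thesis
    using assms weight by (auto simp: weight_function_def)
qed

lemma weight_cofaces:
  assumes "\<tau> \<in> faces X k" "k < int n"
  shows "(\<Sum>\<sigma> | \<sigma> \<in> faces X (k + 1) \<and> \<tau> \<subseteq> \<sigma>. m \<sigma>) = m \<tau>"
proof -
  have "k \<ge> -1"
    using assms(1) unfolding faces_def by auto
  then show ?thesis
    using assms weight by (auto simp: weight_function_def)
qed

lemma cochain_inner_nonneg:
  assumes "k \<le> int n"
  shows "cochain_inner X m k \<phi> \<phi> \<ge> 0"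
  unfolding cochain_inner_def
proof (rule sum_nonneg)
  fix \<sigma> assume "\<sigma> \<in> faces X k"
  then have "m \<sigma> > 0"
    using assms weight_pos by blast
  then show "0 \<le> m \<sigma> * \<phi> \<sigma> * \<phi> \<sigma>"
    by (simp add: mult.assoc)
qed

lemma cochain_norm_sq:
  "k \<le> int n \<Longrightarrow> (cochain_norm X m k \<phi>)\<^sup>2 = cochain_inner X m k \<phi> \<phi>"
  by (simp add: cochain_norm_def cochain_inner_nonneg)

lemma cochain_Cauchy_Schwarz:
  assumes "k \<le> int n"
  shows "(cochain_inner X m k \<phi> \<psi>)\<^sup>2 \<le> cochain_inner X m k \<phi> \<phi> * cochain_inner X m k \<psi> \<psi>"
proof -
  have nn: "\<sigma> \<in> faces X k \<Longrightarrow> sqrt (m \<sigma>) * sqrt (m \<sigma>) = m \<sigma>" for \<sigma>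
    using weight_pos[OF _ assms, of \<sigma>] by simp
  have *: "cochain_inner X m k \<alpha> \<beta> = (\<Sum>\<sigma>\<in>faces X k. (sqrt (m \<sigma>) * \<alpha> \<sigma>) * (sqrt (m \<sigma>) * \<beta> \<sigma>))"
    for \<alpha> \<beta>
    unfolding cochain_inner_def
  proof (rule sum.cong[OF refl])
    fix \<sigma> assume "\<sigma> \<in> faces X k"
    then have "(sqrt (m \<sigma>) * sqrt (m \<sigma>)) * (\<alpha> \<sigma> * \<beta> \<sigma>) = m \<sigma> * (\<alpha> \<sigma> * \<beta> \<sigma>)"
      by (simp only: nn)
    then show "m \<sigma> * \<alpha> \<sigma> * \<beta> \<sigma> = (sqrt (m \<sigma>) * \<alpha> \<sigma>) * (sqrt (m \<sigma>) * \<beta> \<sigma>)"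
      by (simp only: mult_ac)
  qed
  show ?thesis
    unfolding * using Cauchy_Schwarz_ineq_sum[of "\<lambda>\<sigma>. sqrt (m \<sigma>) * \<phi> \<sigma>" "\<lambda>\<sigma>. sqrt (m \<sigma>) * \<psi> \<sigma>"]
    by (simp add: power2_eq_square)
qed

lemma weight_codiff:
  assumes "\<tau> \<in> faces X k" "k \<le> int n"
  shows "m \<tau> * codiff X m k \<phi> \<tau> = (\<Sum>\<sigma> | \<sigma> \<in> faces X (k + 1) \<and> \<tau> \<subseteq> \<sigma>. m \<sigma> * \<phi> \<sigma>)"
  using weight_pos[OF assms] assms(1) by (simp add: codiff_def sum_distrib_left)

lemma codiff_adjoint:
  assumes "k \<le> int n"
  shows "cochain_inner X m (k + 1) (signless_diff X k \<psi>) \<phi> = cochain_inner X m k \<psi> (codiff X m k \<phi>)"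
proof -
  have "cochain_inner X m (k + 1) (signless_diff X k \<psi>) \<phi> =
      (\<Sum>\<sigma>\<in>faces X (k + 1). \<Sum>\<tau> | \<tau> \<in> faces X k \<and> \<tau> \<subseteq> \<sigma>. m \<sigma> * \<psi> \<tau> * \<phi> \<sigma>)"
    by (simp add: cochain_inner_def signless_diff_def sum_distrib_left sum_distrib_right)
  also have "\<dots> = (\<Sum>\<tau>\<in>faces X k. \<Sum>\<sigma> | \<sigma> \<in> faces X (k + 1) \<and> \<tau> \<subseteq> \<sigma>. m \<sigma> * \<psi> \<tau> * \<phi> \<sigma>)"
    by (rule sum.swap_restrict) simp_all
  also have "\<dots> = (\<Sum>\<tau>\<in>faces X k. \<psi> \<tau> * (m \<tau> * codiff X m k \<phi> \<tau>))"
    by (rule sum.cong) (simp_all add: weight_codiff[OF _ assms] sum_distrib_left algebra_simps)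
  also have "\<dots> = cochain_inner X m k \<psi> (codiff X m k \<phi>)"
    by (simp add: cochain_inner_def algebra_simps)
  finally show ?thesis .
qed

lemma card_facets:
  assumes "\<sigma> \<in> faces X (int k + 1)"
  shows "card {\<tau> \<in> faces X (int k). \<tau> \<subseteq> \<sigma>} = k + 2"
proof -
  have c: "card \<sigma> = k + 2" and f: "finite \<sigma>" and s: "\<sigma> \<in> X"
    using assms finite_face[OF assms] by (auto simp: faces_def)
  have "{\<tau> \<in> faces X (int k). \<tau> \<subseteq> \<sigma>} = {\<tau>. \<tau> \<subseteq> \<sigma> \<and> card \<tau> = k + 1}"
    using subface[OF s] by (auto simp: faces_def)
  then show ?thesis
    using n_subsets[OF f, of "k + 1"] c by simp
qed

text \<open>
  Mean zero is orthogonality to the constants, and the differential takes constants to constants,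
  since every \<open>(k+1)\<close>-face has the same number \<open>k + 2\<close> of facets.
\<close>

lemma codiff_cochains0:
  assumes "int k \<le> int n" "\<phi> \<in> cochains0 X m (int k + 1)"
  shows "codiff X m (int k) \<phi> \<in> cochains0 X m (int k)"
proof -
  have "(\<Sum>\<tau>\<in>faces X (int k). m \<tau> * codiff X m (int k) \<phi> \<tau>) =
      (\<Sum>\<tau>\<in>faces X (int k). \<Sum>\<sigma> | \<sigma> \<in> faces X (int k + 1) \<and> \<tau> \<subseteq> \<sigma>. m \<sigma> * \<phi> \<sigma>)"
    using weight_codiff[OF _ assms(1)] by simp
  also have "\<dots> = (\<Sum>\<sigma>\<in>faces X (int k + 1). \<Sum>\<tau> | \<tau> \<in> faces X (int k) \<and> \<tau> \<subseteq> \<sigma>. m \<sigma> * \<phi> \<sigma>)"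
    by (rule sum.swap_restrict) simp_all
  also have "\<dots> = (\<Sum>\<sigma>\<in>faces X (int k + 1). real (k + 2) * (m \<sigma> * \<phi> \<sigma>))"
    by (rule sum.cong) (simp_all only: card_facets sum_constant refl)
  also have "\<dots> = 0"
    using assms(2) by (simp add: sum_distrib_left[symmetric] cochains0_def)
  finally show ?thesis
    by (simp add: cochains0_def cochains_def codiff_def)
qed

section \<open>The norm of the differential as a sum over adjacent faces\<close>

text \<open>
  Two distinct faces of equal dimension have at most one common coface of the next dimension,
  because their union already has too many vertices to be a proper subset of it.
\<close>

lemma adjacent_cofaces:
  assumes "\<sigma> \<in> faces X j" "\<sigma>' \<in> faces X j" "\<sigma> \<noteq> \<sigma>'"
  shows "{\<rho> \<in> faces X (j + 1). \<sigma> \<subseteq> \<rho> \<and> \<sigma>' \<subseteq> \<rho>} =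
    (if \<sigma> \<union> \<sigma>' \<in> faces X (j + 1) then {\<sigma> \<union> \<sigma>'} else {})"
proof -
  have "\<rho> = \<sigma> \<union> \<sigma>'" if \<rho>: "\<rho> \<in> faces X (j + 1)" "\<sigma> \<subseteq> \<rho>" "\<sigma>' \<subseteq> \<rho>" for \<rho>
  proof (rule sym, rule card_seteq)
    show "finite \<rho>"
      using \<rho> finite_face by blast
    show "\<sigma> \<union> \<sigma>' \<subseteq> \<rho>"
      using \<rho> by blast
    have fin: "finite \<sigma>" "finite \<sigma>'"
      using assms finite_face by blast+
    have "\<not> \<sigma>' \<subseteq> \<sigma>"
      using card_subset_eq[OF fin(1), of \<sigma>'] assms by (auto simp: faces_def)
    then have "card \<sigma> < card (\<sigma> \<union> \<sigma>')"
      using fin by (intro psubset_card_mono) auto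
    then show "card \<rho> \<le> card (\<sigma> \<union> \<sigma>')"
      using assms(1) \<rho>(1) by (auto simp: faces_def)
  qed
  then have "{\<rho> \<in> faces X (j + 1). \<sigma> \<subseteq> \<rho> \<and> \<sigma>' \<subseteq> \<rho>} =
      {\<rho>. \<rho> = \<sigma> \<union> \<sigma>' \<and> \<sigma> \<union> \<sigma>' \<in> faces X (j + 1)}"
    by blast
  then show ?thesis
    by simp
qed

text \<open>
  Dually, two faces whose union is a face of the next dimension meet in a single facet of both. This
  is why the sum over all links counts each adjacent pair once.
\<close>

lemma adjacent_common_facets:
  assumes "\<sigma> \<in> faces X j" "\<sigma>' \<in> faces X j" "\<sigma> \<union> \<sigma>' \<in> faces X (j + 1)"
  shows "{\<tau> \<in> faces X (j - 1). \<tau> \<subseteq> \<sigma> \<and> \<tau> \<subseteq> \<sigma>'} = {\<sigma> \<inter> \<sigma>'}"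
proof -
  have fin: "finite \<sigma>" "finite \<sigma>'"
    using assms finite_face by blast+
  have c: "int (card (\<sigma> \<inter> \<sigma>')) = j"
    using card_Un_Int[OF fin] assms by (auto simp: faces_def)
  have "\<sigma> \<inter> \<sigma>' \<in> X"
    using assms(1) subface[of \<sigma> "\<sigma> \<inter> \<sigma>'"] by (simp add: faces_def)
  then have mem: "\<sigma> \<inter> \<sigma>' \<in> faces X (j - 1)"
    using c by (simp add: faces_def)
  have "\<tau> = \<sigma> \<inter> \<sigma>'" if \<tau>: "\<tau> \<in> faces X (j - 1)" "\<tau> \<subseteq> \<sigma>" "\<tau> \<subseteq> \<sigma>'" for \<tau>
  proof (rule card_subset_eq)
    show "card \<tau> = card (\<sigma> \<inter> \<sigma>')"
      using \<tau>(1) c by (simp add: faces_def)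
  qed (use \<tau> fin in auto)
  with mem show ?thesis
    by blast
qed

text \<open>
  The quadratic form of the non-lazy upper walk on the \<open>j\<close>-faces, and the common value of
  the off-diagonal part of \<open>\<parallel>d \<phi>\<parallel>\<^sup>2\<close> and of the link sums of \<open>\<langle>(M')\<^sup>+ \<phi>\<^sub>\<tau>, \<phi>\<^sub>\<tau>\<rangle>\<close>.
  The pairs with \<open>\<sigma> = \<sigma>'\<close> drop out, as their union has dimension \<open>j\<close>.
\<close>

definition adjacency_form :: "int \<Rightarrow> ('a set \<Rightarrow> real) \<Rightarrow> real" where
  "adjacency_form j \<phi> =
     (\<Sum>\<sigma>\<in>faces X j. \<Sum>\<sigma>'\<in>faces X j.
        if \<sigma> \<union> \<sigma>' \<in> faces X (j + 1) then m (\<sigma> \<union> \<sigma>') * \<phi> \<sigma> * \<phi> \<sigma>' else 0)"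

text \<open>
  Expanding the square, the coefficient of \<open>\<phi> \<sigma> * \<phi> \<sigma>'\<close> is the total weight of the common
  \<open>(j+1)\<close>-cofaces: \<open>m \<sigma>\<close> on the diagonal by balance of the weight, and otherwise
  the weight of \<open>\<sigma> \<union> \<sigma>'\<close> or \<open>0\<close>.
\<close>

lemma diff_norm_adjacency:
  assumes "j < int n"
  shows "cochain_inner X m (j + 1) (signless_diff X j \<phi>) (signless_diff X j \<phi>) =
    cochain_inner X m j \<phi> \<phi> + adjacency_form j \<phi>"
proof -
  let ?w = "\<lambda>\<sigma> \<sigma>'. \<Sum>\<rho> | \<rho> \<in> faces X (j + 1) \<and> (\<sigma> \<subseteq> \<rho> \<and> \<sigma>' \<subseteq> \<rho>). m \<rho>"
  have w: "\<phi> \<sigma> * \<phi> \<sigma>' * ?w \<sigma> \<sigma>' = (if \<sigma>' = \<sigma> then m \<sigma> * \<phi> \<sigma> * \<phi> \<sigma> else 0) +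
      (if \<sigma> \<union> \<sigma>' \<in> faces X (j + 1) then m (\<sigma> \<union> \<sigma>') * \<phi> \<sigma> * \<phi> \<sigma>' else 0)"
    if s: "\<sigma> \<in> faces X j" "\<sigma>' \<in> faces X j" for \<sigma> \<sigma>'
  proof (cases "\<sigma>' = \<sigma>")
    case True
    have "\<sigma> \<notin> faces X (j + 1)"
      using s by (auto simp: faces_def)
    then show ?thesis
      using True weight_cofaces[OF s(1) assms] by simp
  next
    case False
    then show ?thesis
      using adjacent_cofaces[OF s] by simp
  qed
  have "cochain_inner X m (j + 1) (signless_diff X j \<phi>) (signless_diff X j \<phi>) =
      (\<Sum>\<rho>\<in>faces X (j + 1). \<Sum>\<sigma>\<in>faces X j. \<Sum>\<sigma>'\<in>faces X j.
         if \<sigma> \<subseteq> \<rho> \<and> \<sigma>' \<subseteq> \<rho> then \<phi> \<sigma> * \<phi> \<sigma>' * m \<rho> else 0)"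
    unfolding cochain_inner_def
  proof (rule sum.cong[OF refl])
    fix \<rho> assume "\<rho> \<in> faces X (j + 1)"
    then have d: "signless_diff X j \<phi> \<rho> = (\<Sum>\<sigma>\<in>faces X j. if \<sigma> \<subseteq> \<rho> then \<phi> \<sigma> else 0)"
      by (simp add: signless_diff_def sum.inter_filter)
    have sq: "signless_diff X j \<phi> \<rho> * signless_diff X j \<phi> \<rho> =
        (\<Sum>\<sigma>\<in>faces X j. \<Sum>\<sigma>'\<in>faces X j. if \<sigma> \<subseteq> \<rho> \<and> \<sigma>' \<subseteq> \<rho> then \<phi> \<sigma> * \<phi> \<sigma>' else 0)"
      unfolding d sum_product by (intro sum.cong refl) simp
    show "m \<rho> * signless_diff X j \<phi> \<rho> * signless_diff X j \<phi> \<rho> =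
        (\<Sum>\<sigma>\<in>faces X j. \<Sum>\<sigma>'\<in>faces X j. if \<sigma> \<subseteq> \<rho> \<and> \<sigma>' \<subseteq> \<rho> then \<phi> \<sigma> * \<phi> \<sigma>' * m \<rho> else 0)"
      unfolding mult.assoc sq sum_distrib_left by (intro sum.cong refl) simp
  qed
  also have "\<dots> = (\<Sum>\<sigma>\<in>faces X j. \<Sum>\<sigma>'\<in>faces X j. \<Sum>\<rho>\<in>faces X (j + 1).
         if \<sigma> \<subseteq> \<rho> \<and> \<sigma>' \<subseteq> \<rho> then \<phi> \<sigma> * \<phi> \<sigma>' * m \<rho> else 0)"
    by (subst sum.swap, rule sum.cong[OF refl], rule sum.swap)
  also have "\<dots> = (\<Sum>\<sigma>\<in>faces X j. \<Sum>\<sigma>'\<in>faces X j. \<phi> \<sigma> * \<phi> \<sigma>' * ?w \<sigma> \<sigma>')"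
    unfolding sum.inter_filter[OF finite_faces] sum_distrib_left
    by (intro sum.cong refl) simp
  also have "\<dots> = cochain_inner X m j \<phi> \<phi> + adjacency_form j \<phi>"
    by (simp add: w sum.distrib cochain_inner_def adjacency_form_def)
  finally show ?thesis .
qed

section \<open>Localization to links\<close>

lemma link_vertex_iff:
  "\<eta> \<in> faces (link X \<tau>) 0 \<longleftrightarrow> (\<exists>v. \<eta> = {v} \<and> v \<notin> \<tau> \<and> insert v \<tau> \<in> X)"
  using subface[of "insert _ \<tau>" "{_}"]
  by (auto simp: faces_def link_def card_1_singleton_iff)

lemma link_vertices_bij:
  assumes "\<tau> \<in> faces X (j - 1)"
  shows "bij_betw ((\<union>) \<tau>) (faces (link X \<tau>) 0) {\<sigma> \<in> faces X j. \<tau> \<subseteq> \<sigma>}"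
proof (rule bij_betwI[where g = "\<lambda>\<sigma>. \<sigma> - \<tau>"])
  have fin: "finite \<tau>" and c: "int (card \<tau>) = j"
    using assms finite_face[OF assms] by (auto simp: faces_def)
  show "(\<union>) \<tau> \<in> faces (link X \<tau>) 0 \<rightarrow> {\<sigma> \<in> faces X j. \<tau> \<subseteq> \<sigma>}"
  proof
    fix \<eta> assume "\<eta> \<in> faces (link X \<tau>) 0"
    then obtain v where "\<eta> = {v}" "v \<notin> \<tau>" "insert v \<tau> \<in> X"
      unfolding link_vertex_iff by blast
    then show "\<tau> \<union> \<eta> \<in> {\<sigma> \<in> faces X j. \<tau> \<subseteq> \<sigma>}"
      using fin c by (auto simp: faces_def)
  qed
  show "(\<lambda>\<sigma>. \<sigma> - \<tau>) \<in> {\<sigma> \<in> faces X j. \<tau> \<subseteq> \<sigma>} \<rightarrow> faces (link X \<tau>) 0"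
  proof
    fix \<sigma> assume s: "\<sigma> \<in> {\<sigma> \<in> faces X j. \<tau> \<subseteq> \<sigma>}"
    then have "card (\<sigma> - \<tau>) = 1"
      using fin c by (auto simp: card_Diff_subset faces_def)
    moreover have "\<sigma> - \<tau> \<in> X" "\<tau> \<union> (\<sigma> - \<tau>) \<in> X"
      using s subface[of \<sigma> "\<sigma> - \<tau>"] by (auto simp: faces_def Un_absorb1)
    ultimately show "\<sigma> - \<tau> \<in> faces (link X \<tau>) 0"
      by (auto simp: faces_def link_def)
  qed
  show "(\<tau> \<union> \<eta>) - \<tau> = \<eta>" if "\<eta> \<in> faces (link X \<tau>) 0" for \<eta>
    using that by (auto simp: link_vertex_iff)
  show "\<tau> \<union> (\<sigma> - \<tau>) = \<sigma>" if "\<sigma> \<in> {\<sigma> \<in> faces X j. \<tau> \<subseteq> \<sigma>}" for \<sigma>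
    using that by auto
qed

lemma sum_link_vertices:
  assumes "\<tau> \<in> faces X (j - 1)"
  shows "(\<Sum>\<eta>\<in>faces (link X \<tau>) 0. g (\<tau> \<union> \<eta>)) = (\<Sum>\<sigma> | \<sigma> \<in> faces X j \<and> \<tau> \<subseteq> \<sigma>. g \<sigma>)"
  using sum.reindex_bij_betw[OF link_vertices_bij[OF assms], of g] by simp

lemma link_edge_iff:
  assumes "\<tau> \<in> faces X (j - 1)" "\<eta> \<in> faces (link X \<tau>) 0" "\<omega> \<in> faces (link X \<tau>) 0"
  shows "\<eta> \<union> \<omega> \<in> faces (link X \<tau>) 1 \<longleftrightarrow> (\<tau> \<union> \<eta>) \<union> (\<tau> \<union> \<omega>) \<in> faces X (j + 1)"
proof -
  have fin: "finite \<tau>" and c: "int (card \<tau>) = j"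
    using assms(1) finite_face[OF assms(1)] by (auto simp: faces_def)
  have d: "(\<eta> \<union> \<omega>) \<inter> \<tau> = {}" "finite (\<eta> \<union> \<omega>)"
    using assms(2,3) by (auto simp: link_vertex_iff)
  have e: "(\<tau> \<union> \<eta>) \<union> (\<tau> \<union> \<omega>) = \<tau> \<union> (\<eta> \<union> \<omega>)"
    by blast
  have "card (\<tau> \<union> (\<eta> \<union> \<omega>)) = card \<tau> + card (\<eta> \<union> \<omega>)"
    using fin d by (intro card_Un_disjoint) auto
  then show ?thesis
    unfolding e using c d subface[of "\<tau> \<union> (\<eta> \<union> \<omega>)" "\<eta> \<union> \<omega>"]
    by (auto simp: faces_def link_def)
qed

text \<open>
  In the link of \<open>\<tau>\<close> the transition probabilities of the non-lazy walk sum to one, so the walk fixes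
  constants. The reason is that, once a facet \<open>\<tau>\<close> of \<open>\<sigma>\<close> is chosen, each \<open>(j+1)\<close>-coface \<open>\<rho>\<close> of
  \<open>\<sigma>\<close> arises from exactly one neighbour through \<open>\<tau>\<close>, namely \<open>\<tau> \<union> (\<rho> - \<sigma>)\<close>.
\<close>

lemma link_vertex_degree:
  assumes \<sigma>: "\<sigma> \<in> faces X j" "\<tau> \<subseteq> \<sigma>" and \<tau>: "\<tau> \<in> faces X (j - 1)" and j: "j < int n"
  shows "(\<Sum>\<sigma>' | \<sigma>' \<in> faces X j \<and> \<tau> \<subseteq> \<sigma>' \<and> \<sigma> \<union> \<sigma>' \<in> faces X (j + 1). m (\<sigma> \<union> \<sigma>')) = m \<sigma>"
proof -
  have fin: "finite \<tau>" "finite \<sigma>"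
    using finite_face \<sigma> \<tau> by blast+
  have "bij_betw ((\<union>) \<sigma>)
      {\<sigma>'. \<sigma>' \<in> faces X j \<and> \<tau> \<subseteq> \<sigma>' \<and> \<sigma> \<union> \<sigma>' \<in> faces X (j + 1)}
      {\<rho> \<in> faces X (j + 1). \<sigma> \<subseteq> \<rho>}" (is "bij_betw _ ?A ?B")
  proof (rule bij_betwI[where g = "\<lambda>\<rho>. \<tau> \<union> (\<rho> - \<sigma>)"])
    show "(\<union>) \<sigma> \<in> ?A \<rightarrow> ?B"
      by auto
    show "(\<lambda>\<rho>. \<tau> \<union> (\<rho> - \<sigma>)) \<in> ?B \<rightarrow> ?A"
    proof
      fix \<rho> assume \<rho>: "\<rho> \<in> ?B"
      then have "finite \<rho>"
        using finite_face by blast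
      then have "card (\<tau> \<union> (\<rho> - \<sigma>)) = card \<tau> + (card \<rho> - card \<sigma>)"
        using fin \<sigma>(2) \<rho> by (subst card_Un_disjoint) (auto simp: card_Diff_subset)
      moreover have "\<tau> \<union> (\<rho> - \<sigma>) \<in> X"
        using \<rho> \<sigma>(2) subface[of \<rho> "\<tau> \<union> (\<rho> - \<sigma>)"] by (auto simp: faces_def)
      moreover have "\<sigma> \<union> (\<tau> \<union> (\<rho> - \<sigma>)) = \<rho>"
        using \<rho> \<sigma>(2) by auto
      ultimately show "\<tau> \<union> (\<rho> - \<sigma>) \<in> ?A"
        using \<rho> \<sigma>(1) \<tau> by (auto simp: faces_def)
    qed
    show "\<tau> \<union> ((\<sigma> \<union> \<sigma>') - \<sigma>) = \<sigma>'" if "\<sigma>' \<in> ?A" for \<sigma>'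
    proof -
      have "\<tau> = \<sigma> \<inter> \<sigma>'"
        using adjacent_common_facets[OF \<sigma>(1), of \<sigma>'] \<sigma>(2) \<tau> that by blast
      then show ?thesis
        by blast
    qed
    show "\<sigma> \<union> (\<tau> \<union> (\<rho> - \<sigma>)) = \<rho>" if "\<rho> \<in> ?B" for \<rho>
      using that \<sigma>(2) by auto
  qed
  from sum.reindex_bij_betw[OF this, of m] show ?thesis
    using weight_cofaces[OF \<sigma>(1) j] by simp
qed

text \<open>
  The local term transported from the link of \<open>\<tau>\<close> to the \<open>j\<close>-faces above \<open>\<tau>\<close>. The lower walk
  replaces \<open>\<phi>\<^sub>\<tau>\<close> by its mean, which is the codifferential at \<open>\<tau>\<close>; as the upper walk fixes that constant,
  its contribution is \<open>m \<tau>\<close> times the square of the mean.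
\<close>

lemma local_form_eq:
  assumes \<tau>: "\<tau> \<in> faces X (j - 1)" and j: "j < int n"
  shows "local_form X m \<phi> \<tau> =
    (\<Sum>\<sigma>\<in>faces X j. \<Sum>\<sigma>'\<in>faces X j. if \<tau> \<subseteq> \<sigma> \<and> \<tau> \<subseteq> \<sigma>' \<and> \<sigma> \<union> \<sigma>' \<in> faces X (j + 1)
       then m (\<sigma> \<union> \<sigma>') * \<phi> \<sigma> * \<phi> \<sigma>' else 0)
    - m \<tau> * codiff X m (j - 1) \<phi> \<tau> * codiff X m (j - 1) \<phi> \<tau>"
proof -
  let ?V = "faces (link X \<tau>) 0"
  let ?S = "{\<sigma> \<in> faces X j. \<tau> \<subseteq> \<sigma>}"
  let ?adj = "\<lambda>\<sigma> \<sigma>'. \<sigma> \<union> \<sigma>' \<in> faces X (j + 1)"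
  define a where "a = codiff X m (j - 1) \<phi> \<tau>"
  have ma: "m \<tau> * a = (\<Sum>\<sigma>\<in>?S. m \<sigma> * \<phi> \<sigma>)"
    unfolding a_def using weight_codiff[OF \<tau>] j by simp
  have finS: "finite ?S"
    by simp
  have finV: "finite ?V"
    using bij_betw_finite[OF link_vertices_bij[OF \<tau>]] finS by blast
  have S_pos: "m \<sigma> > 0" if "\<sigma> \<in> ?S" for \<sigma>
    using that weight_pos[of \<sigma> j] j by auto
  have low: "lower_walk (link X \<tau>) (link_weight m \<tau>) (localization X \<tau> \<phi>) \<omega> = a"
    if "\<omega> \<in> ?V" for \<omega>
  proof -
    have "lower_walk (link X \<tau>) (link_weight m \<tau>) (localization X \<tau> \<phi>) \<omega> =
        (\<Sum>\<eta>\<in>?V. m (\<tau> \<union> \<eta>) / m \<tau> * \<phi> (\<tau> \<union> \<eta>))"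
      using that by (simp add: lower_walk_def link_weight_def localization_def)
    also have "\<dots> = (\<Sum>\<sigma>\<in>?S. m \<sigma> / m \<tau> * \<phi> \<sigma>)"
      by (rule sum_link_vertices[OF \<tau>])
    also have "\<dots> = a"
      using \<tau> by (simp add: a_def codiff_def)
    finally show ?thesis .
  qed
  have up: "m (\<tau> \<union> \<eta>) * upper_walk (link X \<tau>) (link_weight m \<tau>)
         (\<lambda>\<eta>. localization X \<tau> \<phi> \<eta> -
            lower_walk (link X \<tau>) (link_weight m \<tau>) (localization X \<tau> \<phi>) \<eta>) \<eta> =
      (\<Sum>\<sigma>'\<in>?S. if ?adj (\<tau> \<union> \<eta>) \<sigma>' then m ((\<tau> \<union> \<eta>) \<union> \<sigma>') * (\<phi> \<sigma>' - a) else 0)"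
    (is "_ * upper_walk _ _ ?f \<eta> = _") if \<eta>: "\<eta> \<in> ?V" for \<eta>
  proof -
    have pos: "m (\<tau> \<union> \<eta>) > 0"
      using S_pos link_vertices_bij[OF \<tau>] \<eta> by (auto simp: bij_betw_def)
    have "m (\<tau> \<union> \<eta>) * upper_walk (link X \<tau>) (link_weight m \<tau>) ?f \<eta> =
        (\<Sum>\<omega> | \<omega> \<in> ?V \<and> \<eta> \<union> \<omega> \<in> faces (link X \<tau>) 1. m (\<tau> \<union> (\<eta> \<union> \<omega>)) * ?f \<omega>)"
      using \<eta> pos by (simp add: upper_walk_def link_weight_def sum_distrib_left)
    also have "\<dots> = (\<Sum>\<omega>\<in>?V. if \<eta> \<union> \<omega> \<in> faces (link X \<tau>) 1
        then m (\<tau> \<union> (\<eta> \<union> \<omega>)) * ?f \<omega> else 0)"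
      by (rule sum.inter_filter[OF finV])
    also have "\<dots> = (\<Sum>\<omega>\<in>?V. if ?adj (\<tau> \<union> \<eta>) (\<tau> \<union> \<omega>)
        then m ((\<tau> \<union> \<eta>) \<union> (\<tau> \<union> \<omega>)) * (\<phi> (\<tau> \<union> \<omega>) - a) else 0)"
    proof (rule sum.cong[OF refl])
      fix \<omega> assume \<omega>: "\<omega> \<in> ?V"
      have "(\<tau> \<union> \<eta>) \<union> (\<tau> \<union> \<omega>) = \<tau> \<union> (\<eta> \<union> \<omega>)"
        by blast
      then show "(if \<eta> \<union> \<omega> \<in> faces (link X \<tau>) 1 then m (\<tau> \<union> (\<eta> \<union> \<omega>)) * ?f \<omega> else 0) =
          (if ?adj (\<tau> \<union> \<eta>) (\<tau> \<union> \<omega>)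
           then m ((\<tau> \<union> \<eta>) \<union> (\<tau> \<union> \<omega>)) * (\<phi> (\<tau> \<union> \<omega>) - a) else 0)"
        using link_edge_iff[OF \<tau> \<eta> \<omega>] low[OF \<omega>] \<omega> by (simp add: localization_def)
    qed
    also have "\<dots> = (\<Sum>\<sigma>'\<in>?S. if ?adj (\<tau> \<union> \<eta>) \<sigma>' then m ((\<tau> \<union> \<eta>) \<union> \<sigma>') * (\<phi> \<sigma>' - a) else 0)"
      by (rule sum_link_vertices[OF \<tau>])
    finally show ?thesis .
  qed
  have deg: "(\<Sum>\<sigma>'\<in>?S. if ?adj \<sigma> \<sigma>' then m (\<sigma> \<union> \<sigma>') else 0) = m \<sigma>" if "\<sigma> \<in> ?S" for \<sigma>
    using link_vertex_degree[OF _ _ \<tau> j, of \<sigma>] that by (simp add: sum.inter_filter[symmetric] conj_assoc)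
  have "local_form X m \<phi> \<tau> =
      (\<Sum>\<eta>\<in>?V. (\<Sum>\<sigma>'\<in>?S. if ?adj (\<tau> \<union> \<eta>) \<sigma>' then m ((\<tau> \<union> \<eta>) \<union> \<sigma>') * (\<phi> \<sigma>' - a) else 0)
        * \<phi> (\<tau> \<union> \<eta>))"
    unfolding local_form_def cochain_inner_def
    by (rule sum.cong[OF refl]) (simp add: up[symmetric] link_weight_def localization_def)
  also have "\<dots> = (\<Sum>\<sigma>\<in>?S. (\<Sum>\<sigma>'\<in>?S. if ?adj \<sigma> \<sigma>' then m (\<sigma> \<union> \<sigma>') * (\<phi> \<sigma>' - a) else 0) * \<phi> \<sigma>)"
    by (rule sum_link_vertices[OF \<tau>])
  also have "\<dots> = (\<Sum>\<sigma>\<in>?S. (\<Sum>\<sigma>'\<in>?S. if ?adj \<sigma> \<sigma>' then m (\<sigma> \<union> \<sigma>') * \<phi> \<sigma> * \<phi> \<sigma>' else 0)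
      - a * (m \<sigma> * \<phi> \<sigma>))"
  proof (rule sum.cong[OF refl])
    fix \<sigma> assume s: "\<sigma> \<in> ?S"
    have "(\<Sum>\<sigma>'\<in>?S. if ?adj \<sigma> \<sigma>' then m (\<sigma> \<union> \<sigma>') * (\<phi> \<sigma>' - a) else 0) * \<phi> \<sigma> =
        (\<Sum>\<sigma>'\<in>?S. (if ?adj \<sigma> \<sigma>' then m (\<sigma> \<union> \<sigma>') * \<phi> \<sigma> * \<phi> \<sigma>' else 0)
           - a * \<phi> \<sigma> * (if ?adj \<sigma> \<sigma>' then m (\<sigma> \<union> \<sigma>') else 0))"
      unfolding sum_distrib_right by (rule sum.cong) (simp_all add: algebra_simps)
    also have "\<dots> = (\<Sum>\<sigma>'\<in>?S. if ?adj \<sigma> \<sigma>' then m (\<sigma> \<union> \<sigma>') * \<phi> \<sigma> * \<phi> \<sigma>' else 0)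
        - a * \<phi> \<sigma> * m \<sigma>"
      by (simp only: sum_subtractf sum_distrib_left[symmetric] deg[OF s])
    finally show "(\<Sum>\<sigma>'\<in>?S. if ?adj \<sigma> \<sigma>' then m (\<sigma> \<union> \<sigma>') * (\<phi> \<sigma>' - a) else 0) * \<phi> \<sigma> =
        (\<Sum>\<sigma>'\<in>?S. if ?adj \<sigma> \<sigma>' then m (\<sigma> \<union> \<sigma>') * \<phi> \<sigma> * \<phi> \<sigma>' else 0) - a * (m \<sigma> * \<phi> \<sigma>)"
      by (simp add: algebra_simps)
  qed
  also have "\<dots> = (\<Sum>\<sigma>\<in>?S. \<Sum>\<sigma>'\<in>?S. if ?adj \<sigma> \<sigma>' then m (\<sigma> \<union> \<sigma>') * \<phi> \<sigma> * \<phi> \<sigma>' else 0)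
      - a * (\<Sum>\<sigma>\<in>?S. m \<sigma> * \<phi> \<sigma>)"
    by (simp only: sum_subtractf sum_distrib_left)
  also have "a * (\<Sum>\<sigma>\<in>?S. m \<sigma> * \<phi> \<sigma>) = m \<tau> * a * a"
    by (simp only: ma[symmetric]) simp
  also have "(\<Sum>\<sigma>\<in>?S. \<Sum>\<sigma>'\<in>?S. if ?adj \<sigma> \<sigma>' then m (\<sigma> \<union> \<sigma>') * \<phi> \<sigma> * \<phi> \<sigma>' else 0) =
      (\<Sum>\<sigma>\<in>faces X j. \<Sum>\<sigma>'\<in>faces X j. if \<tau> \<subseteq> \<sigma> \<and> \<tau> \<subseteq> \<sigma>' \<and> ?adj \<sigma> \<sigma>'
       then m (\<sigma> \<union> \<sigma>') * \<phi> \<sigma> * \<phi> \<sigma>' else 0)"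
    unfolding sum.inter_filter[OF finite_faces]
    by (rule sum.cong[OF refl]) (auto intro!: sum.cong)
  finally show ?thesis
    by (simp add: a_def)
qed

lemma sum_local_form:
  assumes j: "j < int n"
  shows "(\<Sum>\<tau>\<in>faces X (j - 1). local_form X m \<phi> \<tau>) = adjacency_form j \<phi>
    - cochain_inner X m (j - 1) (codiff X m (j - 1) \<phi>) (codiff X m (j - 1) \<phi>)"
proof -
  let ?w = "\<lambda>\<sigma> \<sigma>'. m (\<sigma> \<union> \<sigma>') * \<phi> \<sigma> * \<phi> \<sigma>'"
  let ?adj = "\<lambda>\<sigma> \<sigma>'. \<sigma> \<union> \<sigma>' \<in> faces X (j + 1)"
  have one: "(\<Sum>\<tau>\<in>faces X (j - 1). if \<tau> \<subseteq> \<sigma> \<and> \<tau> \<subseteq> \<sigma>' \<and> ?adj \<sigma> \<sigma>' then ?w \<sigma> \<sigma>' else 0) =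
      (if ?adj \<sigma> \<sigma>' then ?w \<sigma> \<sigma>' else 0)"
    if s: "\<sigma> \<in> faces X j" "\<sigma>' \<in> faces X j" for \<sigma> \<sigma>'
  proof (cases "?adj \<sigma> \<sigma>'")
    case True
    have "(\<Sum>\<tau>\<in>faces X (j - 1). if \<tau> \<subseteq> \<sigma> \<and> \<tau> \<subseteq> \<sigma>' then ?w \<sigma> \<sigma>' else 0) =
        (\<Sum>\<tau> | \<tau> \<in> faces X (j - 1) \<and> (\<tau> \<subseteq> \<sigma> \<and> \<tau> \<subseteq> \<sigma>'). ?w \<sigma> \<sigma>')"
      by (rule sum.inter_filter[symmetric]) simp
    then show ?thesis
      using True adjacent_common_facets[OF s True] by simp
  qed simp
  have "(\<Sum>\<tau>\<in>faces X (j - 1). \<Sum>\<sigma>\<in>faces X j. \<Sum>\<sigma>'\<in>faces X j.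
        if \<tau> \<subseteq> \<sigma> \<and> \<tau> \<subseteq> \<sigma>' \<and> ?adj \<sigma> \<sigma>' then ?w \<sigma> \<sigma>' else 0) =
      (\<Sum>\<sigma>\<in>faces X j. \<Sum>\<sigma>'\<in>faces X j. \<Sum>\<tau>\<in>faces X (j - 1).
        if \<tau> \<subseteq> \<sigma> \<and> \<tau> \<subseteq> \<sigma>' \<and> ?adj \<sigma> \<sigma>' then ?w \<sigma> \<sigma>' else 0)"
    by (subst sum.swap, rule sum.cong[OF refl], rule sum.swap)
  also have "\<dots> = adjacency_form j \<phi>"
    by (simp add: one adjacency_form_def)
  finally show ?thesis
    by (simp add: local_form_eq[OF _ j] sum_subtractf cochain_inner_def)
qed

text \<open>
  The identity that drives the descent: what the local terms miss is again a norm, now of a cochain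
  one dimension lower.
\<close>

lemma diff_norm_recursion:
  assumes "j < int n"
  shows "cochain_inner X m (j + 1) (signless_diff X j \<phi>) (signless_diff X j \<phi>) =
    cochain_inner X m j \<phi> \<phi> + (\<Sum>\<tau>\<in>faces X (j - 1). local_form X m \<phi> \<tau>)
    + cochain_inner X m (j - 1) (codiff X m (j - 1) \<phi>) (codiff X m (j - 1) \<phi>)"
  using diff_norm_adjacency[OF assms] sum_local_form[OF assms] by simp

section \<open>Descent in dimension\<close>

text \<open>
  Trading the codifferential of \<open>\<phi>\<close> for the differential of a cochain \<open>\<xi>\<close> that is no larger than
  \<open>\<phi>\<close>. The direction of \<open>d\<^sup>* \<phi>\<close> suffices, since Cauchy-Schwarz shows that \<open>d\<close> stretches it by at least
  the ratio \<open>\<parallel>d\<^sup>* \<phi>\<parallel> / \<parallel>\<phi>\<parallel>\<close>.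
\<close>

lemma descend:
  assumes k: "int k + 1 \<le> int n" and \<phi>: "\<phi> \<in> cochains0 X m (int k + 1)"
  shows "\<exists>\<xi> \<in> cochains0 X m (int k).
    cochain_inner X m (int k + 1) (signless_diff X (int k) \<xi>) (signless_diff X (int k) \<xi>) =
      cochain_inner X m (int k) (codiff X m (int k) \<phi>) (codiff X m (int k) \<phi>) \<and>
    cochain_inner X m (int k) \<xi> \<xi> \<le> cochain_inner X m (int k + 1) \<phi> \<phi>"
proof -
  define u where "u = codiff X m (int k) \<phi>"
  define U where "U = cochain_inner X m (int k) u u"
  define D where
    "D = cochain_inner X m (int k + 1) (signless_diff X (int k) u) (signless_diff X (int k) u)"
  define F where "F = cochain_inner X m (int k + 1) \<phi> \<phi>"
  have u0: "u \<in> cochains0 X m (int k)"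
    unfolding u_def using codiff_cochains0[OF _ \<phi>] k by simp
  have nn: "U \<ge> 0" "D \<ge> 0" "F \<ge> 0"
    unfolding U_def D_def F_def using k by (auto intro: cochain_inner_nonneg)
  have "U = cochain_inner X m (int k + 1) (signless_diff X (int k) u) \<phi>"
    using codiff_adjoint[of "int k" u \<phi>] k by (simp add: U_def u_def)
  then have CS: "U\<^sup>2 \<le> D * F"
    unfolding D_def F_def using cochain_Cauchy_Schwarz[OF k] by simp
  \<comment> \<open>If \<open>D = 0\<close> then \<open>U = 0\<close> by the inequality above, and \<open>c = 0\<close> is the right value.\<close>
  define c where "c = sqrt (U / D)"
  have c2: "c\<^sup>2 = U / D"
    using nn by (simp add: c_def)
  have "c\<^sup>2 * D = U"
    using CS nn unfolding c2 by (cases "D = 0") auto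
  moreover have "c\<^sup>2 * U \<le> F"
  proof (cases "D = 0")
    case False
    then have "D > 0"
      using nn by simp
    then show ?thesis
      using CS unfolding c2 by (simp add: power2_eq_square pos_divide_le_eq mult.commute)
  qed (use nn in \<open>simp add: c2\<close>)
  ultimately show ?thesis
    using cochains0_scale[OF u0, of c]
    by (intro bexI[of _ "\<lambda>\<sigma>. c * u \<sigma>"])
      (auto simp: signless_diff_scale cochain_inner_scale U_def D_def F_def u_def)
qed

lemma scale_to_norm:
  assumes k: "k \<le> int n" and \<phi>: "\<phi> \<in> cochains0 X m k"
    and a: "0 \<le> a" "a \<le> cochain_inner X m k \<phi> \<phi>"
  shows "\<exists>\<psi> \<in> cochains0 X m k. cochain_inner X m k \<psi> \<psi> = a"
proof -
  define F where "F = cochain_inner X m k \<phi> \<phi>"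
  have "(sqrt (a / F))\<^sup>2 * F = a"
    using a cochain_inner_nonneg[OF k, of \<phi>] by (cases "F = 0") (auto simp: F_def)
  then show ?thesis
    using cochains0_scale[OF \<phi>, of "sqrt (a / F)"]
    by (intro bexI[of _ "\<lambda>\<sigma>. sqrt (a / F) * \<phi> \<sigma>"]) (auto simp: cochain_inner_scale F_def)
qed

text \<open>
  The theorem with squared norms written as inner products, by induction on \<open>k\<close>: the families for
  the cochain \<open>\<xi>\<close> supplied by \<open>descend\<close> are extended by \<open>\<phi>\<close> and by a multiple of \<open>\<phi>\<close> whose squared
  norm is \<open>\<parallel>\<phi>\<parallel>\<^sup>2 - \<parallel>\<xi>\<parallel>\<^sup>2\<close>.
\<close>

lemma decomposition:
  assumes "k < n" "\<phi> \<in> cochains0 X m (int k)"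
  shows "\<exists>\<psi> \<psi>' :: nat \<Rightarrow> 'a set \<Rightarrow> real.
    (\<forall>j\<le>k. \<psi> j \<in> cochains0 X m (int j)) \<and>
    (\<forall>j<k. \<psi>' j \<in> cochains0 X m (int j)) \<and>
    \<psi>' k = \<phi> \<and>
    (\<forall>j\<le>k. cochain_inner X m (int j) (\<psi>' j) (\<psi>' j) =
       (\<Sum>i\<le>j. cochain_inner X m (int i) (\<psi> i) (\<psi> i))) \<and>
    cochain_inner X m (int k + 1) (signless_diff X (int k) \<phi>) (signless_diff X (int k) \<phi>) =
      (\<Sum>j\<le>k. (real k + 1 - real j) * cochain_inner X m (int j) (\<psi> j) (\<psi> j)) +
      (\<Sum>j\<le>k. \<Sum>\<tau>\<in>faces X (int j - 1). local_form X m (\<psi>' j) \<tau>)"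
  using assms
proof (induction k arbitrary: \<phi>)
  case 0
  \<comment> \<open>At the empty face the codifferential is the mean of \<open>\<phi>\<close>: here the descent stops.\<close>
  have "codiff X m (-1) \<phi> \<tau> = 0" if "\<tau> \<in> faces X (-1)" for \<tau>
  proof -
    have "\<tau> = {}"
      using that finite_face[OF that] by (auto simp: faces_def)
    then have "codiff X m (-1) \<phi> \<tau> = (\<Sum>\<sigma>\<in>faces X 0. m \<sigma> * \<phi> \<sigma>) / m {}"
      using that by (simp add: codiff_def sum_divide_distrib)
    then show ?thesis
      using 0 by (simp add: cochains0_def)
  qed
  then have "cochain_inner X m (-1) (codiff X m (-1) \<phi>) (codiff X m (-1) \<phi>) = 0"
    by (simp add: cochain_inner_def)
  then show ?case
    using diff_norm_recursion[of 0 \<phi>] 0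
    by (intro exI[of _ "\<lambda>_. \<phi>"]) simp
next
  case (Suc k)
  have Sk: "int (Suc k) = int k + 1"
    by simp
  obtain \<xi> where \<xi>: "\<xi> \<in> cochains0 X m (int k)"
    and d\<xi>: "cochain_inner X m (int k + 1) (signless_diff X (int k) \<xi>) (signless_diff X (int k) \<xi>) =
      cochain_inner X m (int k) (codiff X m (int k) \<phi>) (codiff X m (int k) \<phi>)"
    and le: "cochain_inner X m (int k) \<xi> \<xi> \<le> cochain_inner X m (int k + 1) \<phi> \<phi>"
    using descend[of k \<phi>] Suc.prems unfolding Sk by auto
  obtain \<psi> \<psi>' where IH: "\<forall>j\<le>k. \<psi> j \<in> cochains0 X m (int j)"
      "\<forall>j<k. \<psi>' j \<in> cochains0 X m (int j)" "\<psi>' k = \<xi>"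
      "\<forall>j\<le>k. cochain_inner X m (int j) (\<psi>' j) (\<psi>' j) =
         (\<Sum>i\<le>j. cochain_inner X m (int i) (\<psi> i) (\<psi> i))"
      "cochain_inner X m (int k + 1) (signless_diff X (int k) \<xi>) (signless_diff X (int k) \<xi>) =
        (\<Sum>j\<le>k. (real k + 1 - real j) * cochain_inner X m (int j) (\<psi> j) (\<psi> j)) +
        (\<Sum>j\<le>k. \<Sum>\<tau>\<in>faces X (int j - 1). local_form X m (\<psi>' j) \<tau>)"
    using Suc.IH[OF _ \<xi>] Suc.prems(1) by auto
  obtain \<theta> where \<theta>: "\<theta> \<in> cochains0 X m (int k + 1)"
    and n\<theta>: "cochain_inner X m (int k + 1) \<theta> \<theta> =
      cochain_inner X m (int k + 1) \<phi> \<phi> - cochain_inner X m (int k) \<xi> \<xi>"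
    using scale_to_norm[of "int k + 1" \<phi>
        "cochain_inner X m (int k + 1) \<phi> \<phi> - cochain_inner X m (int k) \<xi> \<xi>"]
      Suc.prems le cochain_inner_nonneg[of "int k" \<xi>] unfolding Sk by auto
  let ?\<psi> = "\<psi>(Suc k := \<theta>)" and ?\<psi>' = "\<psi>'(Suc k := \<phi>)"
  let ?N = "\<lambda>j. cochain_inner X m (int j) (?\<psi> j) (?\<psi> j)"
  have N: "(\<Sum>i\<le>j. ?N i) = (\<Sum>i\<le>j. cochain_inner X m (int i) (\<psi> i) (\<psi> i))" if "j \<le> k" for j
    using that by (intro sum.cong) auto
  have norms: "cochain_inner X m (int j) (?\<psi>' j) (?\<psi>' j) = (\<Sum>i\<le>j. ?N i)" if "j \<le> Suc k" for j
  proof (cases "j = Suc k")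
    case True
    then show ?thesis
      using N[of k] IH(3) IH(4)[rule_format, of k] n\<theta> by (simp add: add.commute)
  next
    case False
    then have "j \<le> k"
      using that by simp
    then show ?thesis
      using N IH(4) by simp
  qed
  \<comment> \<open>Raising \<open>k\<close> adds one copy of every \<open>\<parallel>\<phi>\<^sup>j\<parallel>\<^sup>2\<close>, and these add up to \<open>\<parallel>\<phi>\<parallel>\<^sup>2\<close>; the new index
     \<open>j = k + 1\<close> has coefficient \<open>0\<close> in the old formula.\<close>
  have "(\<Sum>j\<le>Suc k. (real (Suc k) + 1 - real j) * ?N j) =
      (\<Sum>j\<le>Suc k. (real k + 1 - real j) * ?N j + ?N j)"
    by (rule sum.cong) (simp_all add: algebra_simps)
  also have "\<dots> = (\<Sum>j\<le>Suc k. (real k + 1 - real j) * ?N j) + (\<Sum>j\<le>Suc k. ?N j)"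
    by (rule sum.distrib)
  also have "(\<Sum>j\<le>Suc k. (real k + 1 - real j) * ?N j) =
      (\<Sum>j\<le>k. (real k + 1 - real j) * cochain_inner X m (int j) (\<psi> j) (\<psi> j))"
    by simp
  also have "(\<Sum>j\<le>Suc k. ?N j) = cochain_inner X m (int k + 1) \<phi> \<phi>"
    using norms[of "Suc k"] by (simp add: add.commute)
  finally have weighted: "(\<Sum>j\<le>Suc k. (real (Suc k) + 1 - real j) * ?N j) =
      (\<Sum>j\<le>k. (real k + 1 - real j) * cochain_inner X m (int j) (\<psi> j) (\<psi> j))
      + cochain_inner X m (int k + 1) \<phi> \<phi>" .
  have local_sum: "(\<Sum>j\<le>Suc k. \<Sum>\<tau>\<in>faces X (int j - 1). local_form X m (?\<psi>' j) \<tau>) =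
      (\<Sum>j\<le>k. \<Sum>\<tau>\<in>faces X (int j - 1). local_form X m (\<psi>' j) \<tau>)
      + (\<Sum>\<tau>\<in>faces X (int k). local_form X m \<phi> \<tau>)"
    by simp
  have "cochain_inner X m (int k + 1 + 1)
        (signless_diff X (int k + 1) \<phi>) (signless_diff X (int k + 1) \<phi>) =
      (\<Sum>j\<le>Suc k. (real (Suc k) + 1 - real j) * ?N j) +
      (\<Sum>j\<le>Suc k. \<Sum>\<tau>\<in>faces X (int j - 1). local_form X m (?\<psi>' j) \<tau>)"
    unfolding weighted local_sum
    using diff_norm_recursion[of "int k + 1" \<phi>] Suc.prems(1) d\<xi> IH(5) by simp
  moreover have "\<forall>j\<le>Suc k. ?\<psi> j \<in> cochains0 X m (int j)"
    using IH(1) \<theta> by (auto simp: le_Suc_eq add.commute)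
  moreover have "\<forall>j<Suc k. ?\<psi>' j \<in> cochains0 X m (int j)"
    using IH(2,3) \<xi> by (auto simp: less_Suc_eq)
  ultimately show ?case
    using norms unfolding Sk
    by (intro exI[of _ ?\<psi>] exI[of _ ?\<psi>'] conjI) auto
qed

end

theorem theorem5p2:
  fixes X :: "'a set set" and m :: "'a set \<Rightarrow> real" and n k :: nat
    and \<phi> :: "'a set \<Rightarrow> real"
  assumes "1 \<le> n"
    and "pure_complex n X"
    and "weight_function n X m"
    and "k \<le> n - 1"
    and "\<phi> \<in> cochains0 X m (int k)"
  shows "\<exists>\<psi> \<psi>' :: nat \<Rightarrow> 'a set \<Rightarrow> real.
    (\<forall>j\<le>k. \<psi> j \<in> cochains0 X m (int j)) \<and>
    (\<forall>j<k. \<psi>' j \<in> cochains0 X m (int j)) \<and>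
    \<psi>' k = \<phi> \<and>
    (\<forall>j\<le>k. (cochain_norm X m (int j) (\<psi>' j))\<^sup>2 =
       (\<Sum>i\<le>j. (cochain_norm X m (int i) (\<psi> i))\<^sup>2)) \<and>
    (cochain_norm X m (int k + 1) (signless_diff X (int k) \<phi>))\<^sup>2 =
      (\<Sum>j\<le>k. (real k + 1 - real j) * (cochain_norm X m (int j) (\<psi> j))\<^sup>2) +
      (\<Sum>j\<le>k. \<Sum>\<tau>\<in>faces X (int j - 1).
         cochain_inner (link X \<tau>) (link_weight m \<tau>) 0
           (upper_walk (link X \<tau>) (link_weight m \<tau>)
             (\<lambda>\<eta>. localization X \<tau> (\<psi>' j) \<eta> -
                lower_walk (link X \<tau>) (link_weight m \<tau>) (localization X \<tau> (\<psi>' j)) \<eta>))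
           (localization X \<tau> (\<psi>' j)))"
proof -
  interpret weighted_complex n X m
    using assms(2,3) by unfold_locales
  have kn: "k < n"
    using assms(1,4) by simp
  then have norm: "(cochain_norm X m (int k + 1) f)\<^sup>2 = cochain_inner X m (int k + 1) f f"
      "j \<le> k \<Longrightarrow> (cochain_norm X m (int j) f)\<^sup>2 = cochain_inner X m (int j) f f" for f j
    by (auto intro: cochain_norm_sq)
  have "(\<Sum>i\<le>j. (cochain_norm X m (int i) (\<psi> i))\<^sup>2) =
      (\<Sum>i\<le>j. cochain_inner X m (int i) (\<psi> i) (\<psi> i))" if "j \<le> k" for j \<psi>
    using that by (intro sum.cong) (auto simp: norm)
  then show ?thesis
    using decomposition[OF kn assms(5)] by (simp add: norm local_form_def cong: conj_cong)
qed

end
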